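(* Let $N\ge 2$ and let $\Omega\subset\mathbb{R}^N$ be a bounded domain with boundary of class $C^2$. Let $f\in C^1(\mathbb{R})$ and suppose that $f(t)=p(t)\varphi(t)$ for all $t\in\mathbb{R}$, where $p,\varphi:\mathbb{R}\to\mathbb{R}$ are functions such that $p(t)>0$ for all $t\in\mathbb{R}$ and $\varphi$ is nonincreasing. Then there exists no nonconstant classical solution of $$-\Delta u=f(u)\ \text{ in }\Omega,\qquad u_\nu=0\ \text{ on }\partial\Omega.$$
   Context: A domain is a connected open set. $\nu$ denotes the outward unit normal to $\partial\Omega$ and $u_\nu$ the derivative of $u$ in the direction $\nu$. A classical solution is a function $u\in C^2(\Omega)\cap C^1(\overline\Omega)$ satisfying the equation and the boundary condition pointwise. *)

theory Defs
  imports "HOL-Analysis.Analysis"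
begin

definition C2_on :: "'a::euclidean_space set \<Rightarrow> ('a \<Rightarrow> real) \<Rightarrow> bool" where
  "C2_on S u \<longleftrightarrow>
     (\<exists>(G :: 'a \<Rightarrow> 'a) (H :: 'a \<Rightarrow> 'a \<Rightarrow>\<^sub>L 'a).
        (\<forall>x\<in>S. (GDERIV u x :> G x) \<and> (G has_derivative blinfun_apply (H x)) (at x)) \<and>
        continuous_on S H)"

text \<open>For open \<open>\<Omega>\<close>: \<open>u\<close> is differentiable in \<open>\<Omega>\<close>, and \<open>u\<close> and its gradient extend
  continuously to the closure. The gradient is taken at interior points only, so the values of \<open>u\<close>
  outside the closure are irrelevant.\<close>

definition C1_on_closure :: "'a::euclidean_space set \<Rightarrow> ('a \<Rightarrow> real) \<Rightarrow> bool" where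
  "C1_on_closure \<Omega> u \<longleftrightarrow>
     continuous_on (closure \<Omega>) u \<and>
     (\<exists>G. continuous_on (closure \<Omega>) G \<and> (\<forall>x\<in>\<Omega>. GDERIV u x :> G x))"

text \<open>Near each boundary point, \<open>\<Omega>\<close> is the region above the graph of a \<open>C\<^sup>2\<close> function
  over the hyperplane orthogonal to some unit vector \<open>e\<close>. The function \<open>\<gamma>\<close> is only ever
  evaluated on that hyperplane, at the orthogonal projection of \<open>x\<close>; giving it the whole space as
  its domain is no restriction, since a function on the hyperplane may be extended by composing it
  with the projection.\<close>

definition C2_boundary :: "'a::euclidean_space set \<Rightarrow> bool" where
  "C2_boundary \<Omega> \<longleftrightarrow>
     (\<forall>z\<in>frontier \<Omega>. \<exists>e r \<gamma>. norm e = 1 \<and> 0 < r \<and> C2_on UNIV \<gamma> \<and>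
        \<Omega> \<inter> ball z r = {x \<in> ball z r. \<gamma> (x - (x \<bullet> e) *\<^sub>R e) < x \<bullet> e})"

definition tangent_vectors :: "'a::euclidean_space set \<Rightarrow> 'a \<Rightarrow> 'a set" where
  "tangent_vectors M z =
     {v. \<exists>c \<epsilon>. 0 < \<epsilon> \<and> c C1_differentiable_on {-\<epsilon><..<\<epsilon>} \<and> c ` {-\<epsilon><..<\<epsilon>} \<subseteq> M \<and>
           c 0 = z \<and> (c has_vector_derivative v) (at 0)}"

definition is_outward_unit_normal :: "'a::euclidean_space set \<Rightarrow> 'a \<Rightarrow> 'a \<Rightarrow> bool" where
  "is_outward_unit_normal \<Omega> z \<nu> \<longleftrightarrow>
     norm \<nu> = 1 \<and> (\<forall>v\<in>tangent_vectors (frontier \<Omega>) z. v \<bullet> \<nu> = 0) \<and>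
     (\<forall>\<^sub>F t in at_right 0. z + t *\<^sub>R \<nu> \<notin> closure \<Omega>)"

text \<open>Well defined when the boundary is of class \<open>C\<^sup>2\<close>: see \<open>ex1_outward_unit_normal\<close>
  below.\<close>

definition outward_unit_normal :: "'a::euclidean_space set \<Rightarrow> 'a \<Rightarrow> 'a" where
  "outward_unit_normal \<Omega> z = (THE \<nu>. is_outward_unit_normal \<Omega> z \<nu>)"

text \<open>The derivative is one-sided because \<open>u\<close> is only meaningful on the closure of
  \<open>\<Omega>\<close>, which \<open>z + t\<nu>\<close> leaves for small \<open>t > 0\<close>.\<close>

definition has_normal_derivative ::
    "'a::euclidean_space set \<Rightarrow> ('a \<Rightarrow> real) \<Rightarrow> 'a \<Rightarrow> real \<Rightarrow> bool" where
  "has_normal_derivative \<Omega> u z d \<longleftrightarrow>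
     ((\<lambda>t. u (z + t *\<^sub>R outward_unit_normal \<Omega> z)) has_real_derivative d) (at_left 0)"

definition partial_deriv :: "'a::euclidean_space \<Rightarrow> ('a \<Rightarrow> real) \<Rightarrow> 'a \<Rightarrow> real" where
  "partial_deriv b u x = deriv (\<lambda>t. u (x + t *\<^sub>R b)) 0"

definition laplacian :: "('a::euclidean_space \<Rightarrow> real) \<Rightarrow> 'a \<Rightarrow> real" where
  "laplacian u x = (\<Sum>b\<in>Basis. partial_deriv b (partial_deriv b u) x)"

definition classical_neumann_solution ::
    "'a::euclidean_space set \<Rightarrow> (real \<Rightarrow> real) \<Rightarrow> ('a \<Rightarrow> real) \<Rightarrow> bool" where
  "classical_neumann_solution \<Omega> f u \<longleftrightarrow>
     C2_on \<Omega> u \<and> C1_on_closure \<Omega> u \<and>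
     (\<forall>x\<in>\<Omega>. - laplacian u x = f (u x)) \<and>
     (\<forall>z\<in>frontier \<Omega>. has_normal_derivative \<Omega> u z 0)"

lemma ex1_outward_unit_normal:
  fixes \<Omega> :: "'a::euclidean_space set"
  assumes C2: "C2_boundary \<Omega>" and z: "z \<in> frontier \<Omega>"
  shows "\<exists>!\<nu>. is_outward_unit_normal \<Omega> z \<nu>"
proof -
  obtain e r \<gamma> where e: "norm e = 1" and r: "0 < r" and g2: "C2_on UNIV \<gamma>"
    and eq: "\<Omega> \<inter> ball z r = {x \<in> ball z r. \<gamma> (x - (x \<bullet> e) *\<^sub>R e) < x \<bullet> e}"
    using C2 z unfolding C2_boundary_def by meson
  obtain G :: "'a \<Rightarrow> 'a" and H :: "'a \<Rightarrow> 'a \<Rightarrow>\<^sub>L 'a"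
    where G: "\<And>x. GDERIV \<gamma> x :> G x" and H: "\<And>x. (G has_derivative blinfun_apply (H x)) (at x)"
    using g2 unfolding C2_on_def by blast
  have contG: "continuous_on UNIV G"
    by (rule continuous_at_imp_continuous_on) (use has_derivative_continuous[OF H] in simp)
  have ee: "e \<bullet> e = 1" using e by (simp add: dot_square_norm)
  define P where "P x = x - (x \<bullet> e) *\<^sub>R e" for x
  define g where "g x = \<gamma> (P x) - x \<bullet> e" for x
  define n where "n = P (G (P z)) - e"
  have Pe: "P x \<bullet> e = 0" for x by (simp add: P_def inner_diff_left ee)
  have Padj: "P x \<bullet> y = x \<bullet> P y" for x y
    by (simp add: P_def inner_diff_left inner_diff_right inner_commute)
  have Padd: "P (x + t *\<^sub>R y) = P x + t *\<^sub>R P y" for x y t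
    by (simp add: P_def inner_add_left algebra_simps)
  have Pee: "P e = 0" by (simp add: P_def ee)
  have Om: "x \<in> \<Omega> \<longleftrightarrow> g x < 0" if "x \<in> ball z r" for x
  proof -
    have "x \<in> \<Omega> \<inter> ball z r \<longleftrightarrow> x \<in> {x \<in> ball z r. \<gamma> (x - (x \<bullet> e) *\<^sub>R e) < x \<bullet> e}"
      by (simp only: eq)
    then show ?thesis using that by (simp add: g_def P_def)
  qed
  have derP: "(P has_derivative P) (at x)" for x
    unfolding P_def[abs_def]
    by (intro has_derivative_diff has_derivative_ident has_derivative_scaleR_left has_derivative_inner_left)
  have derg: "(g has_derivative (\<lambda>h. h \<bullet> (P (G (P x)) - e))) (at x)" for x
  proof -
    have 1: "((\<lambda>x. \<gamma> (P x)) has_derivative (\<lambda>h. P h \<bullet> G (P x))) (at x)"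
      using has_derivative_compose[OF derP G[unfolded gderiv_def]] .
    have "(g has_derivative (\<lambda>h. P h \<bullet> G (P x) - h \<bullet> e)) (at x)"
      unfolding g_def[abs_def] by (intro has_derivative_diff 1 has_derivative_inner_left has_derivative_ident)
    then show ?thesis by (simp add: inner_diff_right Padj)
  qed
  have contg: "continuous_on UNIV g"
    by (rule continuous_at_imp_continuous_on) (use has_derivative_continuous[OF derg] in simp)
  have op: "open (ball z r \<inter> {x. g x < 0})" "open (ball z r \<inter> {x. g x > 0})"
    by (intro open_Int open_ball open_Collect_less contg continuous_on_const)+
  have pos: "x \<notin> closure \<Omega>" if "x \<in> ball z r" "g x > 0" for x
  proof -
    have "ball z r \<inter> {x. g x > 0} \<inter> \<Omega> = {}" using Om by force
    then have "ball z r \<inter> {x. g x > 0} \<inter> closure \<Omega> = {}"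
      using open_Int_closure_eq_empty[OF op(2)] by blast
    then show ?thesis using that by blast
  qed
  have neg: "x \<in> interior \<Omega>" if "x \<in> ball z r" "g x < 0" for x
    by (rule interiorI[OF op(1)]) (use that Om in auto)
  have fr: "x \<in> frontier \<Omega> \<longleftrightarrow> g x = 0" if x: "x \<in> ball z r" for x
  proof
    assume "x \<in> frontier \<Omega>" then show "g x = 0"
      using pos[OF x] neg[OF x] unfolding frontier_def by force
  next
    assume g0: "g x = 0"
    have "((\<lambda>t. x + t *\<^sub>R e) \<longlongrightarrow> x + 0 *\<^sub>R e) (at_right 0)" by (intro tendsto_intros)
    then have lim: "((\<lambda>t. x + t *\<^sub>R e) \<longlongrightarrow> x) (at_right 0)" by simp
    have "\<forall>\<^sub>F t in at_right 0. x + t *\<^sub>R e \<in> ball z r"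
      using topological_tendstoD[OF lim open_ball x] .
    then have "\<forall>\<^sub>F t in at_right 0. x + t *\<^sub>R e \<in> closure \<Omega>"
      using eventually_at_right_less[of 0]
    proof eventually_elim
      case (elim t)
      have "g (x + t *\<^sub>R e) = g x - t"
        unfolding g_def by (simp add: Padd Pee inner_add_left ee)
      then have "x + t *\<^sub>R e \<in> \<Omega>" using Om[OF elim(1)] g0 elim(2) by simp
      then show ?case using closure_subset by blast
    qed
    then have "x \<in> closure \<Omega>"
      using Lim_in_closed_set[OF closed_closure _ _ lim] by simp
    moreover have "x \<notin> \<Omega>" using Om[OF x] g0 by simp
    ultimately show "x \<in> frontier \<Omega>" using interior_subset unfolding frontier_def by blast
  qed
  have zb: "z \<in> ball z r" using r by simp
  have gz: "g z = 0" using fr[OF zb] z by simp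
  have ne: "n \<bullet> e = -1" by (simp add: n_def inner_diff_left Pe ee)
  then have n0: "n \<noteq> 0" by auto
  have gam: "\<gamma> (P z) = z \<bullet> e" using gz by (simp add: g_def)
  have dergz: "(g has_derivative (\<lambda>h. h \<bullet> n)) (at x)" if "x = z" for x
    using derg[of z] that by (simp add: n_def)
  have along: "((\<lambda>t. g (z + t *\<^sub>R w)) has_real_derivative (w \<bullet> n)) (at 0)" for w
  proof -
    have "((\<lambda>t. z + t *\<^sub>R w) has_derivative (\<lambda>t. t *\<^sub>R w)) (at 0)"
      using has_derivative_add[OF has_derivative_const[of z] has_derivative_scaleR_left[OF has_derivative_ident, of w]]
      by simp
    then have "((\<lambda>t. g (z + t *\<^sub>R w)) has_derivative (\<lambda>t. (t *\<^sub>R w) \<bullet> n)) (at 0)"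
      by (rule has_derivative_compose) (rule dergz, simp)
    then show ?thesis by (simp add: has_field_derivative_def mult_commute_abs)
  qed
  have inb: "\<forall>\<^sub>F t in at_right 0. z + t *\<^sub>R w \<in> ball z r" for w
  proof -
    have "((\<lambda>t. z + t *\<^sub>R w) \<longlongrightarrow> z + 0 *\<^sub>R w) (at_right 0)" by (intro tendsto_intros)
    then show ?thesis by (rule topological_tendstoD[OF _ open_ball]) (simp add: r)
  qed
  have outw: "\<forall>\<^sub>F t in at_right 0. z + t *\<^sub>R w \<notin> closure \<Omega>" if w: "w \<bullet> n > 0" for w
  proof -
    obtain d where d: "d > 0" "\<And>t. 0 < t \<Longrightarrow> t < d \<Longrightarrow> g (z + t *\<^sub>R w) > 0"
      using DERIV_pos_inc_right[OF along[of w] w] gz by auto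
    have "\<forall>\<^sub>F t in at_right 0. g (z + t *\<^sub>R w) > 0"
      unfolding eventually_at_right_field using d by blast
    with inb[of w] show ?thesis by eventually_elim (use pos in blast)
  qed
  have inw: "\<forall>\<^sub>F t in at_right 0. z + t *\<^sub>R w \<in> closure \<Omega>" if w: "w \<bullet> n < 0" for w
  proof -
    obtain d where d: "d > 0" "\<And>t. 0 < t \<Longrightarrow> t < d \<Longrightarrow> g (z + t *\<^sub>R w) < 0"
      using DERIV_neg_dec_right[OF along[of w] w] gz by auto
    have "\<forall>\<^sub>F t in at_right 0. g (z + t *\<^sub>R w) < 0"
      unfolding eventually_at_right_field using d by blast
    with inb[of w] show ?thesis
      by eventually_elim (use Om closure_subset in blast)
  qed
  have tan: "tangent_vectors (frontier \<Omega>) z = {v. v \<bullet> n = 0}"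
  proof (intro equalityI subsetI CollectI)
    fix v assume "v \<in> tangent_vectors (frontier \<Omega>) z"
    then obtain c \<epsilon> where c: "0 < \<epsilon>" "c ` {-\<epsilon><..<\<epsilon>} \<subseteq> frontier \<Omega>" "c 0 = z"
      "(c has_vector_derivative v) (at 0)"
      unfolding tangent_vectors_def by blast
    have lim: "(c \<longlongrightarrow> z) (nhds 0)"
      using has_vector_derivative_continuous[OF c(4)] c(3) isContD[of 0 c]
      by (metis continuous_at tendsto_nhds_iff)
    have "\<forall>\<^sub>F t in nhds 0. c t \<in> ball z r" using topological_tendstoD[OF lim open_ball zb] .
    moreover have "\<forall>\<^sub>F t in nhds 0. t \<in> {-\<epsilon><..<\<epsilon>}"
      using c(1) by (intro eventually_nhds_in_open) auto
    ultimately have ev: "\<forall>\<^sub>F t in nhds 0. g (c t) = 0"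
      by eventually_elim (use c(2) fr in blast)
    have "((\<lambda>t. g (c t)) has_derivative (\<lambda>t. (t *\<^sub>R v) \<bullet> n)) (at 0)"
      by (rule has_derivative_compose[OF c(4)[unfolded has_vector_derivative_def] dergz[OF c(3)]])
    then have "((\<lambda>t. g (c t)) has_real_derivative (v \<bullet> n)) (at 0)"
      by (simp add: has_field_derivative_def mult_commute_abs)
    then have "((\<lambda>t. 0) has_real_derivative (v \<bullet> n)) (at 0)"
      using DERIV_cong_ev[OF refl ev refl] by simp
    then show "v \<bullet> n = 0" using DERIV_unique DERIV_const by blast
  next
    fix v assume "v \<in> {v. v \<bullet> n = 0}"
    then have v: "P v \<bullet> G (P z) = v \<bullet> e" by (simp add: n_def inner_diff_right Padj)
    define y where "y t = P z + t *\<^sub>R P v" for t :: real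
    define c where "c t = y t + \<gamma> (y t) *\<^sub>R e" for t :: real
    have ye: "y t \<bullet> e = 0" for t by (simp add: y_def inner_add_left Pe)
    have Py: "P (y t) = y t" for t by (simp add: P_def ye)
    have Pc: "P (c t) = y t" for t by (simp add: c_def Padd Py Pee)
    have gc: "g (c t) = 0" for t
      by (simp add: g_def Pc) (simp add: c_def inner_add_left ye ee)
    have dy: "(y has_derivative (\<lambda>s. s *\<^sub>R P v)) (at t)" for t
      using has_derivative_add[OF has_derivative_const[of "P z"] has_derivative_scaleR_left[OF has_derivative_ident, of "P v"]]
      by (simp add: y_def[abs_def])
    have dc: "(c has_vector_derivative (P v + (P v \<bullet> G (y t)) *\<^sub>R e)) (at t)" for t
    proof -
      have "((\<lambda>t. \<gamma> (y t)) has_derivative (\<lambda>s. (s *\<^sub>R P v) \<bullet> G (y t))) (at t)"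
        using has_derivative_compose[OF dy G[unfolded gderiv_def]] .
      then have "(c has_derivative (\<lambda>s. s *\<^sub>R P v + ((s *\<^sub>R P v) \<bullet> G (y t)) *\<^sub>R e)) (at t)"
        unfolding c_def[abs_def] by (intro has_derivative_add dy has_derivative_scaleR_left)
      then show ?thesis by (simp add: has_vector_derivative_def algebra_simps)
    qed
    have c0: "c 0 = z" by (simp add: c_def y_def gam) (simp add: P_def)
    have "c C1_differentiable_on UNIV"
      unfolding C1_differentiable_on_def
    proof (intro exI conjI ballI)
      show "(c has_vector_derivative (P v + (P v \<bullet> G (y t)) *\<^sub>R e)) (at t)" for t by (rule dc)
      have "continuous_on UNIV y" unfolding y_def[abs_def] by (intro continuous_intros)
      then show "continuous_on UNIV (\<lambda>t. P v + (P v \<bullet> G (y t)) *\<^sub>R e)"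
        by (intro continuous_intros continuous_on_compose2[OF contG]) auto
    qed
    then have C1: "c C1_differentiable_on S" for S
      using C1_differentiable_on_subset by blast
    have "isCont c 0" using has_vector_derivative_continuous[OF dc] .
    then obtain \<epsilon> where eps: "\<epsilon> > 0" "\<And>t. dist t 0 < \<epsilon> \<Longrightarrow> dist (c t) (c 0) < r"
      using r unfolding continuous_at_eps_delta by metis
    have "c t \<in> frontier \<Omega>" if "t \<in> {-\<epsilon><..<\<epsilon>}" for t
    proof -
      have "c t \<in> ball z r" using eps(2)[of t] that c0 by (auto simp: dist_commute dist_real_def)
      then show ?thesis using fr gc by blast
    qed
    moreover have "P v + (P v \<bullet> G (y 0)) *\<^sub>R e = v"
      by (simp add: y_def v) (simp add: P_def)
    ultimately show "v \<in> tangent_vectors (frontier \<Omega>) z"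
      unfolding tangent_vectors_def using eps(1) C1 c0 dc[of 0] by (intro CollectI exI[of _ c] exI[of _ \<epsilon>]) auto
  qed
  define \<nu> where "\<nu> = n /\<^sub>R norm n"
  show ?thesis
  proof (rule ex1I[of _ \<nu>])
    have "\<nu> \<bullet> n > 0" using n0 by (simp add: \<nu>_def)
    then have "\<forall>\<^sub>F t in at_right 0. z + t *\<^sub>R \<nu> \<notin> closure \<Omega>" by (rule outw)
    moreover have "norm \<nu> = 1" "\<forall>v\<in>{v. v \<bullet> n = 0}. v \<bullet> \<nu> = 0"
      using n0 by (simp_all add: \<nu>_def)
    ultimately show "is_outward_unit_normal \<Omega> z \<nu>"
      unfolding is_outward_unit_normal_def tan by blast
  next
    fix \<mu> assume mu: "is_outward_unit_normal \<Omega> z \<mu>"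
    define k where "k = (\<mu> \<bullet> n) / (n \<bullet> n)"
    define w where "w = \<mu> - k *\<^sub>R n"
    have wn: "w \<bullet> n = 0" using n0 by (simp add: w_def k_def inner_diff_left)
    then have "w \<bullet> \<mu> = 0" using mu unfolding is_outward_unit_normal_def tan by auto
    then have "w \<bullet> w = 0" using wn by (simp add: w_def inner_diff_right)
    then have muk: "\<mu> = k *\<^sub>R n" by (simp add: w_def)
    have n1: "norm \<mu> = 1" using mu unfolding is_outward_unit_normal_def by simp
    have kn: "\<bar>k\<bar> * norm n = 1" using n1 unfolding muk by simp
    have "\<not> k < 0"
    proof
      assume "k < 0"
      then have "\<mu> \<bullet> n < 0" using n0 by (simp add: muk mult_neg_pos)
      from inw[OF this] have i: "\<forall>\<^sub>F t in at_right 0. z + t *\<^sub>R \<mu> \<in> closure \<Omega>" .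
      have "\<forall>\<^sub>F t in at_right 0. z + t *\<^sub>R \<mu> \<notin> closure \<Omega>"
        using mu unfolding is_outward_unit_normal_def by blast
      with i have "\<forall>\<^sub>F t in at_right (0::real). False" by eventually_elim blast
      then show False by simp
    qed
    then have "k = inverse (norm n)" using kn n0 by (simp add: field_simps)
    then show "\<mu> = \<nu>" by (simp add: muk \<nu>_def)
  qed
qed

end

theory Submission
  imports Defs
begin

text \<open>Let \<open>M\<close> be the maximum of \<open>u\<close> over the closure. If \<open>f M < 0\<close>, then by continuity \<open>u\<close> is
  subharmonic wherever it is close to \<open>M\<close>. Otherwise \<open>\<phi> M \<ge> 0\<close>, so \<open>\<phi> (u x) \<ge> 0\<close> for all \<open>x\<close> by
  monotonicity, \<open>f \<circ> u \<ge> 0\<close>, and \<open>-u\<close> is subharmonic. In either case Hopf's lemma forces constancy: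
  it excludes a strict maximum on the boundary, where the normal derivative vanishes and the \<open>C\<^sup>2\<close>
  regularity gives an interior tangent ball, and it shows that the set of interior maximum points
  is open. Only subharmonicity near the maximum value is needed for this.\<close>

section \<open>Second derivatives at a maximum and the Laplacian as a trace\<close>

text \<open>Restrict \<open>v\<close> to the line through \<open>y\<close> in direction
  \<open>b\<close>. If the second derivative at 0 were positive, the first derivative, which
  vanishes at 0, would be positive just to the right of 0, and the mean value theorem would yield a
  value above the maximum.\<close>

lemma second_derivative_nonpos_at_max:
  fixes v :: "'a::euclidean_space \<Rightarrow> real"
  assumes e: "0 < e"
    and G: "\<And>x. x \<in> ball y e \<Longrightarrow> GDERIV v x :> G x"
    and H: "(G has_derivative H) (at y)"
    and max: "\<And>x. x \<in> ball y e \<Longrightarrow> v x \<le> v y"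
  shows "H b \<bullet> b \<le> 0"
proof (rule ccontr)
  assume "\<not> H b \<bullet> b \<le> 0"
  then have pos: "H b \<bullet> b > 0" by simp
  \<comment> \<open>This rules out \<open>b = 0\<close>, so that the division by
    \<open>norm b\<close> in \<open>d0\<close> is meaningful.\<close>
  have "H 0 = 0" using has_derivative_linear[OF H] linear_0 by blast
  then have b: "b \<noteq> 0" using pos by auto
  define h where "h t = v (y + t *\<^sub>R b)" for t
  define h' where "h' t = G (y + t *\<^sub>R b) \<bullet> b" for t
  define d0 where "d0 = e / norm b"
  have d0: "d0 > 0" using e b by (simp add: d0_def)
  have inb: "y + t *\<^sub>R b \<in> ball y e" if "\<bar>t\<bar> < d0" for t
    using that b by (simp add: d0_def dist_norm field_simps)
  have line: "((\<lambda>t. y + t *\<^sub>R b) has_derivative (\<lambda>t. t *\<^sub>R b)) (at t)" for t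
    by (auto intro!: derivative_eq_intros)
  have h: "(h has_real_derivative h' t) (at t)" if "\<bar>t\<bar> < d0" for t
  proof -
    have "(h has_derivative (\<lambda>s. (s *\<^sub>R b) \<bullet> G (y + t *\<^sub>R b))) (at t)"
      unfolding h_def[abs_def]
      by (rule has_derivative_compose[OF line G[OF inb[OF that], unfolded gderiv_def]])
    then show ?thesis
      by (simp add: has_field_derivative_def h'_def inner_commute mult_commute_abs)
  qed
  have h'0: "(h' has_real_derivative (H b \<bullet> b)) (at 0)"
  proof -
    have "((\<lambda>t. G (y + t *\<^sub>R b)) has_derivative (\<lambda>s. H (s *\<^sub>R b))) (at 0)"
      by (rule has_derivative_compose[OF line]) (use H in simp)
    then have "(h' has_derivative (\<lambda>s. H (s *\<^sub>R b) \<bullet> b)) (at 0)"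
      unfolding h'_def[abs_def] by (rule has_derivative_inner_left)
    then show ?thesis
      by (simp add: has_field_derivative_def linear_cmul[OF has_derivative_linear[OF H]] mult_commute_abs)
  qed
  have "h' 0 = 0"
    by (rule DERIV_local_max[OF h d0])
      (use d0 max inb in \<open>auto simp: h_def\<close>)
  then obtain d1 where d1: "d1 > 0" "\<And>t. 0 < t \<Longrightarrow> t < d1 \<Longrightarrow> 0 < h' t"
    using DERIV_pos_inc_right[OF h'0 pos] by auto
  define t where "t = min d0 d1 / 2"
  have t: "0 < t" "t < d0" "t < d1" using d0 d1 by (auto simp: t_def)
  obtain s where s: "0 < s" "s < t" "h t - h 0 = (t - 0) * h' s"
    using MVT2[OF t(1), of h h'] h t by (metis abs_of_nonneg le_less_trans)
  then have "h t > h 0" using d1(2)[of s] t by (simp add: algebra_simps)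
  then show False using max[OF inb[of t]] t by (simp add: h_def)
qed

text \<open>Bridges the equation, stated with iterated \<open>deriv\<close>, and the maximum
  principles below, stated with the trace of the derivative \<open>H\<close> of the
  gradient.\<close>

lemma laplacian_eq_trace:
  fixes u :: "'a::euclidean_space \<Rightarrow> real"
  assumes S: "open S" "y \<in> S"
    and G: "\<And>x. x \<in> S \<Longrightarrow> GDERIV u x :> G x"
    and H: "(G has_derivative H) (at y)"
  shows "laplacian u y = (\<Sum>b\<in>Basis. H b \<bullet> b)"
proof -
  have "partial_deriv b (partial_deriv b u) y = H b \<bullet> b" for b
  proof -
    have line: "((\<lambda>t. x + t *\<^sub>R b) has_derivative (\<lambda>t. t *\<^sub>R b)) (at t)" for t and x :: 'a
      by (auto intro!: derivative_eq_intros)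
    have p: "partial_deriv b u x = G x \<bullet> b" if "x \<in> S" for x
    proof -
      have "((\<lambda>t. u (x + t *\<^sub>R b)) has_derivative (\<lambda>s. (s *\<^sub>R b) \<bullet> G x)) (at 0)"
        by (rule has_derivative_compose[OF line]) (use G[OF that, unfolded gderiv_def] in simp)
      then have "((\<lambda>t. u (x + t *\<^sub>R b)) has_real_derivative (G x \<bullet> b)) (at 0)"
        by (simp add: has_field_derivative_def inner_commute mult_commute_abs)
      then show ?thesis unfolding partial_deriv_def by (rule DERIV_imp_deriv)
    qed
    have "((\<lambda>t. G (y + t *\<^sub>R b)) has_derivative (\<lambda>s. H (s *\<^sub>R b))) (at 0)"
      by (rule has_derivative_compose[OF line]) (use H in simp)
    then have "((\<lambda>t. G (y + t *\<^sub>R b) \<bullet> b) has_derivative (\<lambda>s. H (s *\<^sub>R b) \<bullet> b)) (at 0)"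
      by (rule has_derivative_inner_left)
    then have d: "((\<lambda>t. G (y + t *\<^sub>R b) \<bullet> b) has_real_derivative (H b \<bullet> b)) (at 0)"
      by (simp add: has_field_derivative_def linear_cmul[OF has_derivative_linear[OF H]] mult_commute_abs)
    \<comment> \<open>The inner partial derivative is identified with \<open>G x \<bullet> b\<close>
      on \<open>S\<close> only; for the outer one, agreement for small \<open>t\<close> is
      enough.\<close>
    have "((\<lambda>t. y + t *\<^sub>R b) \<longlongrightarrow> y + 0 *\<^sub>R b) (nhds 0)"
      by (intro tendsto_intros filterlim_ident)
    then have "\<forall>\<^sub>F t in nhds 0. y + t *\<^sub>R b \<in> S"
      by (rule topological_tendstoD) (use S in auto)
    then have "\<forall>\<^sub>F t in nhds 0. G (y + t *\<^sub>R b) \<bullet> b = partial_deriv b u (y + t *\<^sub>R b)"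
      by eventually_elim (simp add: p)
    then have "((\<lambda>t. partial_deriv b u (y + t *\<^sub>R b)) has_real_derivative (H b \<bullet> b)) (at 0)"
      using d by (simp add: DERIV_cong_ev[OF refl _ refl])
    then show ?thesis unfolding partial_deriv_def[of b "partial_deriv b u"] by (rule DERIV_imp_deriv)
  qed
  then show ?thesis by (simp add: laplacian_def)
qed

section \<open>Hopf's boundary point lemma\<close>

text \<open>On the annulus between the radii \<open>R / 2\<close> and \<open>R\<close>, the
  perturbation \<open>u + q * E\<close> by a radial barrier is largest at \<open>z\<close>. Hence
  \<open>u\<close> drops along the inward normal at least as fast as \<open>q * E\<close> grows,
  that is, at a positive linear rate.\<close>

lemma hopf_boundary_point:
  fixes u :: "'a::euclidean_space \<Rightarrow> real"
  assumes R: "0 < R" and nu: "norm \<nu> = 1"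
    and cont: "continuous_on (cball (z - R *\<^sub>R \<nu>) R) u"
    and G: "\<And>x. x \<in> ball (z - R *\<^sub>R \<nu>) R \<Longrightarrow> GDERIV u x :> G x"
    and H: "\<And>x. x \<in> ball (z - R *\<^sub>R \<nu>) R \<Longrightarrow> (G has_derivative H x) (at x)"
    and sub: "\<And>x. x \<in> ball (z - R *\<^sub>R \<nu>) R \<Longrightarrow> (\<Sum>b\<in>Basis. H x b \<bullet> b) \<ge> 0"
    and le: "\<And>x. x \<in> cball (z - R *\<^sub>R \<nu>) R \<Longrightarrow> u x \<le> u z"
    and less: "\<And>x. x \<in> ball (z - R *\<^sub>R \<nu>) R \<Longrightarrow> u x < u z"
  shows "\<not> ((\<lambda>t. u (z + t *\<^sub>R \<nu>)) has_real_derivative 0) (at_left 0)"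
proof
  assume der: "((\<lambda>t. u (z + t *\<^sub>R \<nu>)) has_real_derivative 0) (at_left 0)"
  define c where "c = z - R *\<^sub>R \<nu>"
  note cont = cont[folded c_def] and G = G[folded c_def] and H = H[folded c_def]
    and sub = sub[folded c_def] and le = le[folded c_def] and less = less[folded c_def]
  \<comment> \<open>Chosen so that the barrier \<open>E\<close> is strictly subharmonic where \<open>R / 2 < norm (x - c)\<close>.\<close>
  define a where "a = (2 * DIM('a) + 1) / R\<^sup>2"
  have a: "a > 0" using R by (simp add: a_def add_nonneg_pos)
  define E where "E x = exp (- a * ((x - c) \<bullet> (x - c)))" for x
  define Q where "Q = exp (- a * R\<^sup>2)"
  define GE where "GE x = (- 2 * a * E x) *\<^sub>R (x - c)" for x
  define HE where "HE x h = (- 2 * a * E x) *\<^sub>R h + (4 * a\<^sup>2 * E x * ((x - c) \<bullet> h)) *\<^sub>R (x - c)" for x h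
  have Epos: "E x > 0" for x by (simp add: E_def)
  have dE: "(E has_derivative (\<lambda>h. h \<bullet> GE x)) (at x)" for x
    unfolding E_def[abs_def] GE_def
    by (auto intro!: derivative_eq_intros simp: fun_eq_iff E_def inner_commute algebra_simps)
  have dGE: "(GE has_derivative HE x) (at x)" for x
    unfolding GE_def[abs_def] HE_def[abs_def]
    by (auto intro!: derivative_eq_intros dE simp: fun_eq_iff GE_def inner_commute algebra_simps power2_eq_square)
  have trE: "(\<Sum>b\<in>Basis. HE x b \<bullet> b) = 2 * a * E x * (2 * a * (norm (x - c))\<^sup>2 - DIM('a))" for x
  proof -
    have "(\<Sum>b\<in>Basis. HE x b \<bullet> b)
        = (\<Sum>b\<in>Basis. - 2 * a * E x + 4 * a\<^sup>2 * E x * (((x - c) \<bullet> b) * ((x - c) \<bullet> b)))"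
      by (rule sum.cong) (simp_all add: HE_def inner_add_left inner_diff_left)
    also have "\<dots> = DIM('a) * (- 2 * a * E x) + 4 * a\<^sup>2 * E x * ((x - c) \<bullet> (x - c))"
      by (subst (3) euclidean_inner) (simp add: sum.distrib sum_distrib_left sum_subtractf)
    also have "\<dots> = 2 * a * E x * (2 * a * (norm (x - c))\<^sup>2 - DIM('a))"
      by (simp add: dot_square_norm algebra_simps power2_eq_square)
    finally show ?thesis .
  qed
  have trE_pos: "(\<Sum>b\<in>Basis. HE x b \<bullet> b) > 0" if "R / 2 < norm (x - c)" for x
  proof -
    have "(R / 2)\<^sup>2 < (norm (x - c))\<^sup>2" using that R by (intro power_strict_mono) auto
    then have "2 * a * (R / 2)\<^sup>2 < 2 * a * (norm (x - c))\<^sup>2" using a by simp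
    moreover have "2 * a * (R / 2)\<^sup>2 = DIM('a) + 1/2"
      using R by (simp add: a_def field_simps power2_eq_square)
    ultimately show ?thesis unfolding trE using a Epos[of x] by (intro mult_pos_pos) auto
  qed
  have "\<exists>y\<in>cball c (R/2). \<forall>x\<in>cball c (R/2). u x \<le> u y"
    by (rule continuous_attains_sup)
      (use R cont in \<open>auto intro: continuous_on_subset\<close>)
  then obtain y0 where y0: "y0 \<in> cball c (R/2)" "\<And>x. x \<in> cball c (R/2) \<Longrightarrow> u x \<le> u y0" by blast
  \<comment> \<open>The gap between \<open>u z\<close> and the maximum of \<open>u\<close> on the
    inner closed ball. As \<open>E \<le> 1\<close>, adding \<open>q * E\<close> does not lift the
    values there above \<open>u z\<close>.\<close>
  define q where "q = u z - u y0"
  have q: "q > 0" using less[of y0] y0 R by (simp add: q_def)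
  define v where "v x = u x + q * E x" for x
  define K where "K = cball c R - ball c (R/2)"
  have "compact K" unfolding K_def by (intro compact_diff) auto
  moreover have "z \<in> K" using nu R by (simp add: K_def c_def dist_norm)
  moreover have contE: "continuous_on S E" for S unfolding E_def[abs_def] by (intro continuous_intros)
  moreover have "continuous_on K v"
    unfolding v_def[abs_def]
    by (intro continuous_intros contE continuous_on_subset[OF cont]) (auto simp: K_def)
  ultimately obtain y where y: "y \<in> K" "\<And>x. x \<in> K \<Longrightarrow> v x \<le> v y"
    using continuous_attains_sup[of K v] by blast
  \<comment> \<open>The right-hand side is \<open>v z\<close>. The outer sphere is handled by
    \<open>le\<close>, the inner one by the choice of \<open>q\<close>; strictly between them a
    maximum is impossible, since the trace of the second derivative of \<open>v\<close> would be
    both positive and nonpositive.\<close>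
  have vQ: "v y \<le> u z + q * Q"
  proof -
    consider "norm (y - c) = R" | "norm (y - c) = R/2" | "R/2 < norm (y - c)" "norm (y - c) < R"
      using y(1) by (force simp: K_def dist_norm norm_minus_commute)
    then show ?thesis
    proof cases
      case 1
      then have "E y = Q" by (simp add: E_def Q_def dot_square_norm)
      then show ?thesis using le[of y] y(1) by (simp add: v_def K_def)
    next
      case 2
      then have "u y \<le> u y0" using y0(2)[of y] by (simp add: dist_norm norm_minus_commute)
      moreover have "q * E y \<le> q * 1" using q a by (intro mult_left_mono) (auto simp: E_def)
      moreover have "q * Q > 0" using q by (simp add: Q_def)
      ultimately show ?thesis by (simp add: v_def q_def)
    next
      case 3
      \<comment> \<open>The distance from \<open>y\<close> to the two bounding spheres, so that
        \<open>ball y e\<close> stays in the annulus.\<close>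
      define e where "e = min (norm (y - c) - R/2) (R - norm (y - c))"
      have e: "e > 0" using 3 by (simp add: e_def)
      have sub1: "x \<in> K \<and> x \<in> ball c R" if "x \<in> ball y e" for x
      proof -
        have "norm (x - c) \<le> norm (x - y) + norm (y - c)" "norm (y - c) \<le> norm (x - y) + norm (x - c)"
          using norm_triangle_ineq[of "x - y" "y - c"] norm_triangle_ineq[of "y - x" "x - c"]
          by (simp_all add: norm_minus_commute)
        moreover have "norm (x - y) < e" using that by (simp add: dist_norm norm_minus_commute)
        ultimately show ?thesis by (auto simp: K_def dist_norm norm_minus_commute e_def)
      qed
      have yb: "y \<in> ball c R" using sub1 e by simp
      have "(H y b + q *\<^sub>R HE y b) \<bullet> b \<le> 0" for b
      proof (rule second_derivative_nonpos_at_max[OF e])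
        show "GDERIV v x :> G x + q *\<^sub>R GE x" if "x \<in> ball y e" for x
          unfolding gderiv_def v_def[abs_def]
          using G[of x] sub1[OF that]
          by (auto intro!: derivative_eq_intros dE simp: gderiv_def fun_eq_iff inner_add_right)
        show "((\<lambda>x. G x + q *\<^sub>R GE x) has_derivative (\<lambda>b. H y b + q *\<^sub>R HE y b)) (at y)"
          by (intro has_derivative_add H yb has_derivative_scaleR_right dGE)
        show "v x \<le> v y" if "x \<in> ball y e" for x using y(2) sub1[OF that] by blast
      qed
      then have "(\<Sum>b\<in>Basis. (H y b + q *\<^sub>R HE y b) \<bullet> b) \<le> 0" by (intro sum_nonpos) auto
      then have "(\<Sum>b\<in>Basis. H y b \<bullet> b) + q * (\<Sum>b\<in>Basis. HE y b \<bullet> b) \<le> 0"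
        by (simp add: inner_add_left sum.distrib sum_distrib_left)
      moreover have "q * (\<Sum>b\<in>Basis. HE y b \<bullet> b) > 0" using q trE_pos[of y] 3 by simp
      ultimately show ?thesis using sub[OF yb] by simp
    qed
  qed
  \<comment> \<open>Half the inward slope of \<open>q * E\<close> at the outer sphere. The other
    half absorbs the quadratic term of the exponent, as \<open>s\<^sup>2 \<le> R * s\<close>. The
    bound \<open>s < R/2\<close> in \<open>dec\<close> keeps the point in the annulus.\<close>
  define k where "k = q * Q * a * R"
  have k: "k > 0" using q a R by (simp add: k_def Q_def)
  have dec: "u (z - s *\<^sub>R \<nu>) \<le> u z - k * s" if s: "0 < s" "s < R/2" for s
  proof -
    have zc: "z - s *\<^sub>R \<nu> - c = (R - s) *\<^sub>R \<nu>" by (simp add: c_def algebra_simps)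
    then have nzc: "norm (z - s *\<^sub>R \<nu> - c) = R - s" using nu s by simp
    then have "dist c (z - s *\<^sub>R \<nu>) = R - s" by (simp add: dist_norm norm_minus_commute)
    then have "z - s *\<^sub>R \<nu> \<in> K" using s R by (simp add: K_def)
    then have 1: "u (z - s *\<^sub>R \<nu>) + q * E (z - s *\<^sub>R \<nu>) \<le> u z + q * Q"
      using y(2) vQ unfolding v_def by fastforce
    have "E (z - s *\<^sub>R \<nu>) = exp (- a * R\<^sup>2 + a * (2 * R * s - s\<^sup>2))"
      unfolding E_def dot_square_norm nzc by (simp add: power2_eq_square algebra_simps)
    also have "\<dots> = Q * exp (a * (2 * R * s - s\<^sup>2))" by (simp only: exp_add Q_def)
    also have "\<dots> \<ge> Q * (1 + a * (R * s))"
    proof -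
      have "s * s \<le> R * s" using s by (intro mult_right_mono) auto
      then have "a * (R * s) \<le> a * (2 * R * s - s\<^sup>2)"
        using a by (simp add: power2_eq_square)
      then have "1 + a * (R * s) \<le> exp (a * (2 * R * s - s\<^sup>2))"
        using exp_ge_add_one_self[of "a * (2 * R * s - s\<^sup>2)"] by linarith
      then show ?thesis by (simp add: Q_def)
    qed
    finally have "q * (Q * (1 + a * (R * s))) \<le> q * E (z - s *\<^sub>R \<nu>)" using q by simp
    then show ?thesis using 1 by (simp add: k_def algebra_simps)
  qed
  \<comment> \<open>For \<open>t < 0\<close> both numerator and denominator are negative, so
    \<open>dec\<close> bounds the quotient below by \<open>k\<close>.\<close>
  have "((\<lambda>t. (u (z + t *\<^sub>R \<nu>) - u z) / t) \<longlongrightarrow> 0) (at_left 0)"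
    using der by (simp add: has_field_derivative_iff)
  then have "\<forall>\<^sub>F t in at_left 0. (u (z + t *\<^sub>R \<nu>) - u z) / t < k"
    using k by (rule order_tendstoD)
  moreover have "\<forall>\<^sub>F t in at_left 0. (t::real) \<in> {-R/2<..<0}"
    using R by (intro eventually_at_leftI) auto
  ultimately have "\<forall>\<^sub>F t in at_left (0::real). False"
  proof eventually_elim
    case (elim t)
    then show ?case using dec[of "- t"] by (simp add: divide_less_eq split: if_splits)
  qed
  then show False by simp
qed

section \<open>The interior tangent ball\<close>

text \<open>Near \<open>z\<close> the set is \<open>{g < 0}\<close> with \<open>g\<close> differing
  from its linear part at \<open>z\<close> by at most a quadratic term. The gradient of
  \<open>g\<close> at \<open>z\<close> is a positive multiple of the normal, so on a small enough
  tangent ball the linear part dominates.\<close>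

lemma interior_ball_at_frontier:
  fixes \<Omega> :: "'a::euclidean_space set"
  assumes C2: "C2_boundary \<Omega>" and op: "open \<Omega>" and z: "z \<in> frontier \<Omega>"
  obtains R where "0 < R" "ball (z - R *\<^sub>R outward_unit_normal \<Omega> z) R \<subseteq> \<Omega>"
    "norm (outward_unit_normal \<Omega> z) = 1"
proof -
  define \<nu> where "\<nu> = outward_unit_normal \<Omega> z"
  have "is_outward_unit_normal \<Omega> z \<nu>"
    unfolding \<nu>_def outward_unit_normal_def by (rule theI'[OF ex1_outward_unit_normal[OF C2 z]])
  then have nu1: "norm \<nu> = 1"
    and nutan: "\<And>v. v \<in> tangent_vectors (frontier \<Omega>) z \<Longrightarrow> v \<bullet> \<nu> = 0"
    and nuout: "\<forall>\<^sub>F t in at_right 0. z + t *\<^sub>R \<nu> \<notin> closure \<Omega>"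
    unfolding is_outward_unit_normal_def by auto
  obtain e r \<gamma> where e: "norm e = 1" and r: "0 < r" and g2: "C2_on UNIV \<gamma>"
    and eq: "\<Omega> \<inter> ball z r = {x \<in> ball z r. \<gamma> (x - (x \<bullet> e) *\<^sub>R e) < x \<bullet> e}"
    using C2 z unfolding C2_boundary_def by meson
  obtain G :: "'a \<Rightarrow> 'a" and H :: "'a \<Rightarrow> 'a \<Rightarrow>\<^sub>L 'a"
    where G: "\<And>x. GDERIV \<gamma> x :> G x" and H: "\<And>x. (G has_derivative blinfun_apply (H x)) (at x)"
    using g2 unfolding C2_on_def by blast
  have ee: "e \<bullet> e = 1" using e by (simp add: dot_square_norm)
  \<comment> \<open>\<open>P\<close> is the orthogonal projection onto the hyperplane of the graph,
    \<open>g\<close> a defining function of the set, and \<open>n\<close> its gradient; the outer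
    \<open>P\<close> in \<open>n\<close> comes from the self-adjointness of
    \<open>P\<close>.\<close>
  define P where "P x = x - (x \<bullet> e) *\<^sub>R e" for x
  define g where "g x = \<gamma> (P x) - x \<bullet> e" for x
  define n where "n x = P (G (P x)) - e" for x
  have P: "linear P"
    unfolding P_def[abs_def] by (intro linearI) (simp_all add: inner_add_left algebra_simps)
  note P_simps = linear_add[OF P] linear_diff[OF P] linear_cmul[OF P]
  have Pe: "P x \<bullet> e = 0" for x by (simp add: P_def inner_diff_left ee)
  have PP: "P (P x) = P x" for x using Pe[of x] by (simp add: P_def[of "P x"])
  have Pee: "P e = 0" by (simp add: P_def ee)
  have Padj: "P x \<bullet> y = x \<bullet> P y" for x y
    by (simp add: P_def inner_diff_left inner_diff_right inner_commute)
  have Pnorm: "norm (P x) \<le> norm x" for x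
  proof (rule power2_le_imp_le)
    have "(norm (P x))\<^sup>2 = x \<bullet> P x" using Padj[of x "P x"] by (simp add: PP dot_square_norm[symmetric])
    also have "\<dots> = (norm x)\<^sup>2 - (x \<bullet> e)\<^sup>2"
      by (simp add: P_def inner_diff_right power2_norm_eq_inner) (simp add: power2_eq_square)
    finally show "(norm (P x))\<^sup>2 \<le> (norm x)\<^sup>2" by simp
  qed simp
  have Om: "x \<in> \<Omega> \<longleftrightarrow> g x < 0" if "x \<in> ball z r" for x
    using that eq unfolding g_def P_def by (auto simp: set_eq_iff)
  have derP: "(P has_derivative P) (at x)" for x
    using P by (simp add: linear_imp_has_derivative)
  have derg: "(g has_derivative (\<lambda>h. h \<bullet> n x)) (at x)" for x
  proof -
    have "((\<lambda>x. \<gamma> (P x)) has_derivative (\<lambda>h. P h \<bullet> G (P x))) (at x)"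
      by (rule has_derivative_compose[OF derP G[unfolded gderiv_def]])
    then have "(g has_derivative (\<lambda>h. P h \<bullet> G (P x) - h \<bullet> e)) (at x)"
      unfolding g_def[abs_def]
      by (intro has_derivative_diff has_derivative_inner_left has_derivative_ident)
    then show ?thesis by (simp add: n_def inner_diff_right Padj)
  qed
  have line: "((\<lambda>t. z + t *\<^sub>R w) has_derivative (\<lambda>t. t *\<^sub>R w)) (at t)" for t w
    by (auto intro!: derivative_eq_intros)
  have along: "((\<lambda>t. g (z + t *\<^sub>R w)) has_real_derivative (w \<bullet> n (z + t *\<^sub>R w))) (at t)" for t w
  proof -
    have "((\<lambda>t. g (z + t *\<^sub>R w)) has_derivative (\<lambda>s. (s *\<^sub>R w) \<bullet> n (z + t *\<^sub>R w))) (at t)"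
      by (rule has_derivative_compose[OF line derg])
    then show ?thesis by (simp add: has_field_derivative_def mult_commute_abs)
  qed
  have contg: "isCont g x" for x by (rule has_derivative_continuous[OF derg])
  have zb: "z \<in> ball z r" using r by simp
  have up: "\<forall>\<^sub>F t in at_right 0. x + t *\<^sub>R w \<in> ball z r" if "x \<in> ball z r" for x w
  proof -
    have "((\<lambda>t. x + t *\<^sub>R w) \<longlongrightarrow> x + 0 *\<^sub>R w) (at_right 0)" by (intro tendsto_intros)
    then show ?thesis by (rule topological_tendstoD[OF _ open_ball]) (use that in simp)
  qed
  have fr: "x \<in> frontier \<Omega>" if x: "x \<in> ball z r" and g0: "g x = 0" for x
  proof -
    have "\<forall>\<^sub>F t in at_right 0. x + t *\<^sub>R e \<in> closure \<Omega>"
      using up[OF x, of e] eventually_at_right_less[of 0]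
    proof eventually_elim
      case (elim t)
      have "g (x + t *\<^sub>R e) = g x - t"
        unfolding g_def by (simp add: P_simps Pee inner_add_left ee)
      then show ?case using Om[OF elim(1)] g0 elim(2) closure_subset by auto
    qed
    moreover have "((\<lambda>t. x + t *\<^sub>R e) \<longlongrightarrow> x + 0 *\<^sub>R e) (at_right 0)" by (intro tendsto_intros)
    ultimately have "x + 0 *\<^sub>R e \<in> closure \<Omega>"
      by (rule Lim_in_closed_set[OF closed_closure _ trivial_limit_at_right_real])
    then have "x \<in> closure \<Omega>" by simp
    moreover have "x \<notin> \<Omega>" using Om[OF x] g0 by simp
    ultimately show ?thesis by (simp add: frontier_def interior_open[OF op])
  qed
  have gz: "g z = 0"
  proof (rule antisym)
    have "z \<in> closure \<Omega>" "z \<notin> \<Omega>" using z op by (auto simp: frontier_def interior_open)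
    then show "0 \<le> g z" using Om[OF zb] by simp
    show "g z \<le> 0"
    proof (rule ccontr)
      assume "\<not> g z \<le> 0"
      then have "\<forall>\<^sub>F x in nhds z. g x > 0"
        using contg[of z] by (intro order_tendstoD) (auto simp: isCont_def tendsto_nhds_iff)
      then obtain U where U: "open U" "z \<in> U" "\<And>x. x \<in> U \<Longrightarrow> g x > 0"
        unfolding eventually_nhds by blast
      have "U \<inter> ball z r \<inter> \<Omega> = {}" using Om U(3) by force
      then have "U \<inter> ball z r \<inter> closure \<Omega> = {}"
        using open_Int_closure_eq_empty[of "U \<inter> ball z r"] U(1) by blast
      then show False using \<open>z \<in> closure \<Omega>\<close> U(2) zb by blast
    qed
  qed
  \<comment> \<open>The curve \<open>c\<close> lifts the line through \<open>P z\<close> with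
    direction \<open>P v\<close> to the graph of \<open>\<gamma>\<close>; its velocity at 0 equals
    \<open>v\<close> precisely because \<open>v \<bullet> n z = 0\<close>.\<close>
  have tan: "v \<in> tangent_vectors (frontier \<Omega>) z" if "v \<bullet> n z = 0" for v
  proof -
    from that have v: "P v \<bullet> G (P z) = v \<bullet> e" by (simp add: n_def inner_diff_right Padj)
    define y where "y t = P z + t *\<^sub>R P v" for t :: real
    define c where "c t = y t + \<gamma> (y t) *\<^sub>R e" for t :: real
    have Py: "P (y t) = y t" and ye: "y t \<bullet> e = 0" for t
      by (simp_all add: y_def P_simps PP inner_add_left Pe)
    have gc: "g (c t) = 0" for t
      by (simp add: g_def c_def P_simps Py Pee inner_add_left ye ee)
    have dy: "(y has_derivative (\<lambda>s. s *\<^sub>R P v)) (at t)" for t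
      unfolding y_def[abs_def] by (auto intro!: derivative_eq_intros)
    have dc: "(c has_vector_derivative (P v + (P v \<bullet> G (y t)) *\<^sub>R e)) (at t)" for t
    proof -
      have "((\<lambda>t. \<gamma> (y t)) has_derivative (\<lambda>s. (s *\<^sub>R P v) \<bullet> G (y t))) (at t)"
        by (rule has_derivative_compose[OF dy G[unfolded gderiv_def]])
      then have "(c has_derivative (\<lambda>s. s *\<^sub>R P v + ((s *\<^sub>R P v) \<bullet> G (y t)) *\<^sub>R e)) (at t)"
        unfolding c_def[abs_def] by (intro has_derivative_add dy has_derivative_scaleR_left)
      then show ?thesis by (simp add: has_vector_derivative_def algebra_simps)
    qed
    have c0: "c 0 = z" using gz by (simp add: c_def y_def g_def) (simp add: P_def)
    have C1: "c C1_differentiable_on S" for S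
      unfolding C1_differentiable_on_def
    proof (intro exI conjI ballI)
      show "(c has_vector_derivative (P v + (P v \<bullet> G (y t)) *\<^sub>R e)) (at t)" for t by (rule dc)
      have contG: "continuous_on UNIV G"
        by (rule continuous_at_imp_continuous_on) (use has_derivative_continuous[OF H] in simp)
      show "continuous_on S (\<lambda>t. P v + (P v \<bullet> G (y t)) *\<^sub>R e)"
        unfolding y_def by (intro continuous_intros continuous_on_compose2[OF contG]) auto
    qed
    have "isCont c 0" using has_vector_derivative_continuous[OF dc] .
    then obtain \<epsilon> where eps: "\<epsilon> > 0" "\<And>t. dist t 0 < \<epsilon> \<Longrightarrow> dist (c t) (c 0) < r"
      using r unfolding continuous_at_eps_delta by metis
    have "c t \<in> frontier \<Omega>" if "t \<in> {-\<epsilon><..<\<epsilon>}" for t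
      using eps(2)[of t] that c0 fr[OF _ gc] by (auto simp: dist_commute dist_real_def)
    moreover have "P v + (P v \<bullet> G (y 0)) *\<^sub>R e = v"
      by (simp add: y_def v) (simp add: P_def)
    ultimately show ?thesis
      unfolding tangent_vectors_def using eps(1) C1 c0 dc[of 0]
      by (intro CollectI exI[of _ c] exI[of _ \<epsilon>]) auto
  qed
  have "n z \<bullet> e = -1" by (simp add: n_def inner_diff_left Pe ee)
  then have n0: "n z \<noteq> 0" by auto
  define k where "k = n z \<bullet> \<nu>"
  \<comment> \<open>The component \<open>w\<close> of \<open>\<nu>\<close> orthogonal to
    \<open>n z\<close> is tangent, hence orthogonal to \<open>\<nu>\<close> as well, and therefore
    to itself.\<close>
  have nk: "n z = k *\<^sub>R \<nu>"
  proof -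
    define j where "j = (\<nu> \<bullet> n z) / (n z \<bullet> n z)"
    define w where "w = \<nu> - j *\<^sub>R n z"
    have wn: "w \<bullet> n z = 0" using n0 by (simp add: w_def j_def inner_diff_left)
    then have "w \<bullet> \<nu> = 0" using nutan[OF tan] by simp
    then have "w \<bullet> (\<nu> - j *\<^sub>R n z) = 0" using wn by (simp only: inner_diff_right) simp
    then have "w = 0" unfolding w_def[symmetric] by simp
    then have j: "\<nu> = j *\<^sub>R n z" unfolding w_def by (simp only: right_minus_eq)
    then have "j \<noteq> 0" using nu1 by auto
    then have nj: "n z = (1 / j) *\<^sub>R \<nu>" using j by simp
    then have "k = 1 / j" unfolding k_def nj by (simp add: dot_square_norm nu1)
    then show ?thesis using nj by simp
  qed
  \<comment> \<open>Otherwise \<open>g\<close> would decrease along \<open>\<nu>\<close>, which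
    would then point into the set.\<close>
  have "k > 0"
  proof (rule ccontr)
    assume "\<not> k > 0"
    moreover have "k \<noteq> 0" using nk n0 by (metis scaleR_zero_left)
    moreover have "\<nu> \<bullet> n z = k" by (simp only: k_def inner_commute)
    ultimately have "\<nu> \<bullet> n z < 0" by linarith
    then obtain d where d: "d > 0" "\<And>t. 0 < t \<Longrightarrow> t < d \<Longrightarrow> g (z + t *\<^sub>R \<nu>) < 0"
      using DERIV_neg_dec_right[OF along[of \<nu> 0]] gz by auto
    have "\<forall>\<^sub>F t in at_right 0. g (z + t *\<^sub>R \<nu>) < 0"
      unfolding eventually_at_right_field using d by blast
    with up[OF zb, of \<nu>] nuout have "\<forall>\<^sub>F t in at_right (0::real). False"
      by eventually_elim (use Om closure_subset in blast)
    then show False by simp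
  qed
  \<comment> \<open>Differentiability of \<open>G\<close> at \<open>P z\<close> with tolerance 1
    gives a Lipschitz estimate based at this one point, with constant
    \<open>1 + norm (H (P z))\<close>.\<close>
  obtain d where d: "d > 0"
    and dG: "\<And>y. norm (y - P z) < d \<Longrightarrow> norm (G y - G (P z) - H (P z) (y - P z)) \<le> 1 * norm (y - P z)"
    using H[of "P z", unfolded has_derivative_at_alt, THEN conjunct2, rule_format, OF zero_less_one]
    by blast
  define K where "K = 1 + norm (H (P z))"
  have K: "K > 0" by (simp add: K_def add_pos_nonneg)
  have lip: "norm (G y - G (P z)) \<le> K * norm (y - P z)" if "norm (y - P z) < d" for y
    using dG[OF that] norm_blinfun[of "H (P z)" "y - P z"]
      norm_triangle_ineq[of "G y - G (P z) - H (P z) (y - P z)" "H (P z) (y - P z)"]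
    by (simp add: K_def algebra_simps)
  \<comment> \<open>Mean value theorem on the segment from \<open>z\<close> to \<open>x\<close>;
    since \<open>P\<close> does not increase norms, \<open>lip\<close> controls the change of the
    gradient.\<close>
  have taylor: "g x \<le> (x - z) \<bullet> n z + K * (norm (x - z))\<^sup>2" if x: "norm (x - z) < d" for x
  proof -
    obtain s where s: "0 < s" "s < 1"
      "g (z + 1 *\<^sub>R (x - z)) - g (z + 0 *\<^sub>R (x - z)) = (1 - 0) * ((x - z) \<bullet> n (z + s *\<^sub>R (x - z)))"
      using MVT2[of 0 1 "\<lambda>t. g (z + t *\<^sub>R (x - z))", OF zero_less_one along] by blast
    define y where "y = z + s *\<^sub>R (x - z)"
    have "norm (P y - P z) \<le> norm (y - z)" using Pnorm[of "y - z"] by (simp add: P_simps)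
    also have "\<dots> \<le> norm (x - z)" using s by (simp add: y_def mult_left_le_one_le)
    finally have yx: "norm (P y - P z) \<le> norm (x - z)" .
    have "norm (n y - n z) = norm (P (G (P y) - G (P z)))" by (simp add: n_def P_simps)
    also have "\<dots> \<le> norm (G (P y) - G (P z))" by (rule Pnorm)
    also have "\<dots> \<le> K * norm (P y - P z)" by (rule lip) (use yx x in simp)
    also have "\<dots> \<le> K * norm (x - z)" using yx K by simp
    finally have "norm (x - z) * norm (n y - n z) \<le> norm (x - z) * (K * norm (x - z))"
      by (intro mult_left_mono) auto
    then have "(x - z) \<bullet> (n y - n z) \<le> K * (norm (x - z))\<^sup>2"
      using norm_cauchy_schwarz[of "x - z" "n y - n z"] by (simp add: power2_eq_square mult_ac)
    then show ?thesis using s(3) gz by (simp add: y_def[symmetric] inner_diff_right)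
  qed
  \<comment> \<open>Points of the tangent ball lie within \<open>2 * R\<close> of \<open>z\<close>,
    whence \<open>r/2\<close> and \<open>d/2\<close>; the third bound lets the linear term absorb
    the quadratic one.\<close>
  define R where "R = min (min (r/2) (d/2)) (k / (2 * K))"
  have R: "R > 0" "2 * R \<le> r" "2 * R \<le> d" using r d K \<open>k > 0\<close> by (auto simp: R_def)
  have "R \<le> k / (2 * K)" by (simp add: R_def)
  then have RK: "2 * R * K \<le> k" using K by (simp add: pos_le_divide_eq mult_ac)
  have "x \<in> \<Omega>" if x: "x \<in> ball (z - R *\<^sub>R \<nu>) R" for x
  proof -
    have xR: "norm (x - z + R *\<^sub>R \<nu>) < R"
      using x by (simp add: dist_norm norm_minus_commute algebra_simps)
    have "norm (x - z) \<le> norm (x - z + R *\<^sub>R \<nu>) + norm (R *\<^sub>R \<nu>)"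
      using norm_triangle_ineq4[of "x - z + R *\<^sub>R \<nu>" "R *\<^sub>R \<nu>"] by simp
    then have xz: "norm (x - z) < 2 * R" using xR nu1 R by simp
    have "(norm (x - z + R *\<^sub>R \<nu>))\<^sup>2 < R\<^sup>2" using xR by (intro power_strict_mono) auto
    moreover have "(norm (x - z + R *\<^sub>R \<nu>))\<^sup>2 = (norm (x - z))\<^sup>2 + 2 * R * ((x - z) \<bullet> \<nu>) + R\<^sup>2"
      using nu1 by (simp add: power2_norm_eq_inner inner_add_left inner_add_right inner_commute norm_eq_1)
        (simp add: power2_eq_square algebra_simps)
    \<comment> \<open>This is membership in the tangent ball with the square expanded;
      \<open>k\<close> times its left-hand side bounds \<open>2 * R * g x\<close> from
      above.\<close>
    ultimately have tilt: "(norm (x - z))\<^sup>2 + 2 * R * ((x - z) \<bullet> \<nu>) < 0" by simp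
    have "2 * R * g x \<le> 2 * R * ((x - z) \<bullet> n z + K * (norm (x - z))\<^sup>2)"
      using taylor[of x] xz R by (intro mult_left_mono) auto
    also have "\<dots> = k * (2 * R * ((x - z) \<bullet> \<nu>)) + (2 * R * K) * (norm (x - z))\<^sup>2"
      by (simp add: nk algebra_simps)
    also have "\<dots> \<le> k * (2 * R * ((x - z) \<bullet> \<nu>)) + k * (norm (x - z))\<^sup>2"
      using RK by (intro add_left_mono mult_right_mono) auto
    also have "\<dots> = k * ((norm (x - z))\<^sup>2 + 2 * R * ((x - z) \<bullet> \<nu>))" by (simp add: algebra_simps)
    also have "\<dots> < 0" using tilt \<open>k > 0\<close> by (simp add: mult_pos_neg)
    finally have "g x < 0" using R by (simp add: mult_less_0_iff)
    then show ?thesis using Om[of x] xz R by (simp add: dist_norm norm_minus_commute)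
  qed
  then show thesis using that[of R] R nu1 unfolding \<nu>_def by blast
qed

section \<open>The strong maximum principle under the Neumann condition\<close>

text \<open>The set \<open>Z\<close> of maximum points in \<open>\<Omega>\<close> is nonempty, open
  and relatively closed, so connectedness gives \<open>Z = \<Omega>\<close> and continuity extends
  this to the closure.\<close>

lemma neumann_strong_maximum_principle:
  fixes u :: "'a::euclidean_space \<Rightarrow> real"
  assumes op: "open \<Omega>" and conn: "connected \<Omega>" and C2: "C2_boundary \<Omega>"
    and cont: "continuous_on (closure \<Omega>) u"
    and G: "\<And>x. x \<in> \<Omega> \<Longrightarrow> GDERIV u x :> G x"
    and H: "\<And>x. x \<in> \<Omega> \<Longrightarrow> (G has_derivative H x) (at x)"
    and neumann: "\<And>z. z \<in> frontier \<Omega> \<Longrightarrow> has_normal_derivative \<Omega> u z 0"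
    and \<xi>: "\<xi> \<in> closure \<Omega>" and max: "\<And>x. x \<in> closure \<Omega> \<Longrightarrow> u x \<le> u \<xi>"
    and \<delta>: "0 < \<delta>"
    and sub: "\<And>x. x \<in> \<Omega> \<Longrightarrow> u \<xi> - \<delta> < u x \<Longrightarrow> (\<Sum>b\<in>Basis. H x b \<bullet> b) \<ge> 0"
  shows "u constant_on closure \<Omega>"
proof -
  \<comment> \<open>A form of Hopf's lemma serving both boundary and interior points
    \<open>y\<close>. The ball is shrunk, keeping it tangent at \<open>y\<close>, until
    \<open>u\<close> exceeds \<open>u \<xi> - \<delta>\<close> on it, where \<open>sub\<close>
    applies.\<close>
  have touch: "\<not> ((\<lambda>t. u (y + t *\<^sub>R \<nu>)) has_real_derivative 0) (at_left 0)"
    if R: "R > 0" and nu: "norm \<nu> = 1" and inO: "ball (y - R *\<^sub>R \<nu>) R \<subseteq> \<Omega>"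
      and y: "u y = u \<xi>" and less: "\<And>x. x \<in> ball (y - R *\<^sub>R \<nu>) R \<Longrightarrow> u x < u \<xi>"
    for y \<nu> R
  proof -
    have "y \<in> cball (y - R *\<^sub>R \<nu>) R" using nu R by (simp add: dist_norm)
    then have "y \<in> closure (ball (y - R *\<^sub>R \<nu>) R)" using R by simp
    then have "y \<in> closure \<Omega>" using closure_mono[OF inO] by blast
    then obtain d where d: "d > 0" "\<And>x. x \<in> closure \<Omega> \<Longrightarrow> dist x y < d \<Longrightarrow> dist (u x) (u y) < \<delta>"
      using cont \<delta> unfolding continuous_on_iff by metis
    define \<rho> where "\<rho> = min R (d / 2)"
    have \<rho>: "\<rho> > 0" "\<rho> \<le> R" "2 * \<rho> \<le> d" using R d by (auto simp: \<rho>_def)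
    have bR: "ball (y - \<rho> *\<^sub>R \<nu>) \<rho> \<subseteq> ball (y - R *\<^sub>R \<nu>) R"
    proof -
      have "y - \<rho> *\<^sub>R \<nu> - (y - R *\<^sub>R \<nu>) = (R - \<rho>) *\<^sub>R \<nu>" by (simp add: algebra_simps)
      then have "dist (y - \<rho> *\<^sub>R \<nu>) (y - R *\<^sub>R \<nu>) = R - \<rho>" using nu \<rho> by (simp add: dist_norm)
      then show ?thesis by (simp add: ball_subset_ball_iff)
    qed
    with inO have bO: "ball (y - \<rho> *\<^sub>R \<nu>) \<rho> \<subseteq> \<Omega>" by blast
    have cO: "cball (y - \<rho> *\<^sub>R \<nu>) \<rho> \<subseteq> closure \<Omega>" using closure_mono[OF bO] \<rho> by simp
    show ?thesis
    proof (rule hopf_boundary_point[OF \<rho>(1) nu])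
      show "continuous_on (cball (y - \<rho> *\<^sub>R \<nu>) \<rho>) u" by (rule continuous_on_subset[OF cont cO])
      show "u x \<le> u y" if "x \<in> cball (y - \<rho> *\<^sub>R \<nu>) \<rho>" for x using max cO that y by auto
      fix x assume x: "x \<in> ball (y - \<rho> *\<^sub>R \<nu>) \<rho>"
      then have xO: "x \<in> \<Omega>" using bO by blast
      show "GDERIV u x :> G x" "(G has_derivative H x) (at x)" using G H xO by blast+
      show "u x < u y" using less bR x y by auto
      have "dist x y \<le> dist (y - \<rho> *\<^sub>R \<nu>) x + dist (y - \<rho> *\<^sub>R \<nu>) y"
        by (metis dist_commute dist_triangle)
      also have "\<dots> < d" using x \<rho> nu by (simp add: dist_norm)
      finally have "dist (u x) (u y) < \<delta>" using d xO closure_subset by blast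
      then show "(\<Sum>b\<in>Basis. H x b \<bullet> b) \<ge> 0"
        using sub[OF xO] y by (simp add: dist_real_def abs_less_iff)
    qed
  qed
  define Z where "Z = {x \<in> \<Omega>. u x = u \<xi>}"
  have "Z \<noteq> {}"
  proof
    assume "Z = {}"
    then have ne: "u x \<noteq> u \<xi>" if "x \<in> \<Omega>" for x using that by (auto simp: Z_def)
    then have less: "u x < u \<xi>" if "x \<in> \<Omega>" for x
      using max[of x] that closure_subset[of \<Omega>] by (force simp: less_le)
    have fr: "\<xi> \<in> frontier \<Omega>" using ne \<xi> op by (auto simp: frontier_def interior_open)
    show False
      by (rule interior_ball_at_frontier[OF C2 op fr])
        (use touch less neumann[OF fr, unfolded has_normal_derivative_def] in blast)
  qed
  moreover have "openin (top_of_set \<Omega>) Z"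
  proof -
    have "\<exists>T>0. ball y T \<subseteq> Z" if y: "y \<in> Z" for y
    proof -
      obtain r where r: "r > 0" "ball y r \<subseteq> \<Omega>"
        using op y openE by (metis (mono_tags, lifting) Z_def mem_Collect_eq)
      \<comment> \<open>If \<open>x\<close> were not in \<open>Z\<close>, the largest ball about
        \<open>x\<close> free of maximum points would touch \<open>Z\<close> at some
        \<open>p\<close>, where Hopf's lemma contradicts the vanishing gradient. The radius
        \<open>r/2\<close> keeps \<open>cball x (dist x y)\<close> inside
        \<open>\<Omega>\<close>.\<close>
      have "x \<in> Z" if x: "x \<in> ball y (r/2)" for x
      proof (rule ccontr)
        assume xZ: "x \<notin> Z"
        have xO: "x \<in> \<Omega>" using r x by (auto simp: subset_iff)
        have cx: "cball x (dist x y) \<subseteq> \<Omega>"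
        proof
          fix w assume "w \<in> cball x (dist x y)"
          then have "dist y w < r"
            using x dist_triangle[of y w x] by (simp add: dist_commute)
          then show "w \<in> \<Omega>" using r by auto
        qed
        have contO: "continuous_on \<Omega> u" by (rule continuous_on_subset[OF cont closure_subset])
        \<comment> \<open>\<open>Z\<close> is closed only relative to \<open>\<Omega>\<close>, so
          the distance from \<open>x\<close> is minimised over this compact part of it, which
          contains \<open>y\<close>.\<close>
        define W where "W = {w \<in> cball x (dist x y). u w = u \<xi>}"
        have "compact W"
        proof -
          have "closed W" unfolding W_def
            by (intro continuous_closed_preimage_constant continuous_on_subset[OF contO cx] closed_cball)
          moreover have "bounded W" by (rule bounded_subset[OF bounded_cball]) (auto simp: W_def)
          ultimately show ?thesis by (simp add: compact_eq_bounded_closed)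
        qed
        moreover have "y \<in> W" using y by (auto simp: W_def Z_def)
        ultimately obtain p where p: "p \<in> W" "\<And>w. w \<in> W \<Longrightarrow> dist x p \<le> dist x w"
          using distance_attains_inf[of W x] compact_imp_closed by blast
        have pO: "p \<in> \<Omega>" and up: "u p = u \<xi>" using p(1) cx by (auto simp: W_def)
        define d where "d = dist x p"
        have "p \<noteq> x" using up xZ xO by (auto simp: Z_def)
        then have d: "d > 0" by (simp add: d_def)
        define \<nu> where "\<nu> = (p - x) /\<^sub>R d"
        have nu: "norm \<nu> = 1" using d by (simp add: \<nu>_def d_def dist_norm norm_minus_commute)
        have px: "p - d *\<^sub>R \<nu> = x" using d by (simp add: \<nu>_def)
        have bx: "ball x d \<subseteq> cball x (dist x y)" using p(1) by (auto simp: W_def d_def)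
        have "u w < u \<xi>" if w: "w \<in> ball x d" for w
        proof -
          have "w \<in> \<Omega>" using w bx cx by blast
          then have "u w \<le> u \<xi>" using max closure_subset by blast
          moreover have "w \<notin> W" using p(2)[of w] w by (auto simp: d_def)
          then have "u w \<noteq> u \<xi>" using w bx by (auto simp: W_def)
          ultimately show ?thesis by simp
        qed
        then have no: "\<not> ((\<lambda>t. u (p + t *\<^sub>R \<nu>)) has_real_derivative 0) (at_left 0)"
          using touch[OF d nu, of p] px bx cx up by auto
        have "(\<lambda>h. h \<bullet> G p) = (\<lambda>h. 0)"
          by (rule differential_zero_maxmin[OF pO op G[OF pO, unfolded gderiv_def]])
            (use max closure_subset up in auto)
        then have du: "(u has_derivative (\<lambda>h. 0)) (at (p + 0 *\<^sub>R \<nu>))"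
          using G[OF pO] by (simp add: gderiv_def)
        have "((\<lambda>t. u (p + t *\<^sub>R \<nu>)) has_derivative (\<lambda>h. 0)) (at 0)"
          by (rule has_derivative_compose[where g = u and g' = "\<lambda>h. 0"
                and f = "\<lambda>t. p + t *\<^sub>R \<nu>", OF _ du])
            (auto intro!: derivative_eq_intros)
        then have "((\<lambda>t. u (p + t *\<^sub>R \<nu>)) has_real_derivative 0) (at 0)"
          by (simp add: has_field_derivative_def lambda_zero)
        then show False using no has_field_derivative_at_within by blast
      qed
      then show ?thesis using r by (intro exI[of _ "r/2"]) auto
    qed
    then have "open Z" unfolding open_contains_ball by blast
    then show ?thesis by (intro open_subset) (auto simp: Z_def)
  qed
  moreover have "closedin (top_of_set \<Omega>) Z"
    unfolding Z_def
    by (intro continuous_closedin_preimage_constant continuous_on_subset[OF cont closure_subset])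
  ultimately have "Z = \<Omega>" using conn unfolding connected_clopen by blast
  then have "u x = u \<xi>" if "x \<in> closure \<Omega>" for x
    by (intro continuous_constant_on_closure[OF cont _ that]) (auto simp: Z_def)
  then show ?thesis unfolding constant_on_def by blast
qed

section \<open>Nonexistence, by the sign of \<open>f\<close> at the maximum value of
  \<open>u\<close>\<close>

theorem corollary1p3:
  fixes \<Omega> :: "(real ^ 'n) set" and f p \<phi> :: "real \<Rightarrow> real"
  assumes "CARD('n) \<ge> 2"
    and "open \<Omega>" "connected \<Omega>" "bounded \<Omega>" "C2_boundary \<Omega>"
    and "f C1_differentiable_on UNIV"
    and "\<And>t. f t = p t * \<phi> t"
    and "\<And>t. p t > 0"
    and "antimono \<phi>"
  shows "\<not> (\<exists>u. classical_neumann_solution \<Omega> f u \<and> \<not> u constant_on closure \<Omega>)"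
proof (intro notI, elim exE conjE)
  fix u assume sol: "classical_neumann_solution \<Omega> f u" and nc: "\<not> u constant_on closure \<Omega>"
  then obtain G :: "real ^ 'n \<Rightarrow> real ^ 'n" and H :: "real ^ 'n \<Rightarrow> (real ^ 'n) \<Rightarrow>\<^sub>L (real ^ 'n)"
    where G: "\<And>x. x \<in> \<Omega> \<Longrightarrow> GDERIV u x :> G x"
      and H: "\<And>x. x \<in> \<Omega> \<Longrightarrow> (G has_derivative blinfun_apply (H x)) (at x)"
    unfolding classical_neumann_solution_def C2_on_def by blast
  have cont: "continuous_on (closure \<Omega>) u"
    and neumann: "\<And>z. z \<in> frontier \<Omega> \<Longrightarrow> has_normal_derivative \<Omega> u z 0"
    and pde: "\<And>x. x \<in> \<Omega> \<Longrightarrow> - laplacian u x = f (u x)"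
    using sol unfolding classical_neumann_solution_def C1_on_closure_def by auto
  have tr: "(\<Sum>b\<in>Basis. H x b \<bullet> b) = - f (u x)" if "x \<in> \<Omega>" for x
    using laplacian_eq_trace[OF assms(2) that G H[OF that]] pde[OF that] by simp
  have "compact (closure \<Omega>)" using assms(4) by simp
  \<comment> \<open>Every function is constant on the empty set, so nonconstancy supplies a
    point.\<close>
  moreover have "closure \<Omega> \<noteq> {}" using nc by (auto simp: constant_on_def)
  ultimately obtain x0 where x0: "x0 \<in> closure \<Omega>" "\<And>x. x \<in> closure \<Omega> \<Longrightarrow> u x \<le> u x0"
    and "\<exists>x1\<in>closure \<Omega>. \<forall>x\<in>closure \<Omega>. u x1 \<le> u x"
    using continuous_attains_sup[of "closure \<Omega>" u] continuous_attains_inf[of "closure \<Omega>" u] cont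
    by metis
  then obtain x1 where x1: "x1 \<in> closure \<Omega>" "\<And>x. x \<in> closure \<Omega> \<Longrightarrow> u x1 \<le> u x" by blast
  show False
  proof (cases "f (u x0) < 0")
    case True
    have "isCont f (u x0)"
      using C1_differentiable_imp_continuous_on[OF assms(6)] by (simp add: continuous_on_eq_continuous_at)
    \<comment> \<open>With tolerance \<open>- f (u x0)\<close>, \<open>f\<close> remains negative
      within \<open>\<delta>\<close> of the maximum value.\<close>
    then obtain \<delta> where \<delta>: "\<delta> > 0" "\<And>t. dist t (u x0) < \<delta> \<Longrightarrow> dist (f t) (f (u x0)) < - f (u x0)"
      using True unfolding continuous_at_eps_delta by (metis neg_0_less_iff_less)
    have "u constant_on closure \<Omega>"
    proof (rule neumann_strong_maximum_principle[OF assms(2,3,5) cont G H neumann x0 \<delta>(1)])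
      fix x assume x: "x \<in> \<Omega>" "u x0 - \<delta> < u x"
      then have "u x \<le> u x0" using x0(2) closure_subset by blast
      then have "f (u x) < 0" using \<delta>(2)[of "u x"] x by (auto simp: dist_real_def)
      then show "(\<Sum>b\<in>Basis. H x b \<bullet> b) \<ge> 0" using tr x by simp
    qed
    then show False using nc by simp
  next
    case False
    \<comment> \<open>As \<open>p\<close> is positive, \<open>f\<close> and \<open>\<phi>\<close>
      have the same sign; monotonicity of \<open>\<phi>\<close> carries it from the maximum value to
      all smaller values.\<close>
    then have phi0: "\<phi> (u x0) \<ge> 0" using assms(8)[of "u x0"] by (simp add: assms(7) mult_less_0_iff not_less)
    have "(\<lambda>x. - u x) constant_on closure \<Omega>"
    \<comment> \<open>The minimum point \<open>x1\<close> of \<open>u\<close> is a maximum point of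
      \<open>-u\<close>. The value 1 for \<open>\<delta>\<close> is arbitrary, since
      \<open>-u\<close> is subharmonic on all of \<open>\<Omega>\<close>.\<close>
    proof (rule neumann_strong_maximum_principle[OF assms(2,3,5), where \<xi> = x1 and \<delta> = 1
          and G = "\<lambda>x. - G x" and H = "\<lambda>x h. - H x h"])
      show "GDERIV (\<lambda>x. - u x) x :> - G x" if "x \<in> \<Omega>" for x
        using has_derivative_minus[OF G[OF that, unfolded gderiv_def]] by (simp add: gderiv_def)
      show "((\<lambda>x. - G x) has_derivative (\<lambda>h. - H x h)) (at x)" if "x \<in> \<Omega>" for x
        by (rule has_derivative_minus[OF H[OF that]])
      show "has_normal_derivative \<Omega> (\<lambda>x. - u x) z 0" if "z \<in> frontier \<Omega>" for z
        using DERIV_minus[OF neumann[OF that, unfolded has_normal_derivative_def]]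
        by (simp add: has_normal_derivative_def)
      fix x assume x: "x \<in> \<Omega>"
      then have "u x \<le> u x0" using x0(2) closure_subset by blast
      then have "\<phi> (u x) \<ge> 0" using phi0 antimonoD[OF assms(9)] order_trans by blast
      then have "f (u x) \<ge> 0" using assms(7,8) by (simp add: less_imp_le)
      then show "(\<Sum>b\<in>Basis. (- H x b) \<bullet> b) \<ge> 0" using tr[OF x] by (simp add: sum_negf)
    qed (use x1 cont in \<open>auto intro: continuous_on_minus\<close>)
    then obtain k where "\<forall>x\<in>closure \<Omega>. - u x = k" unfolding constant_on_def by blast
    then have "\<forall>x\<in>closure \<Omega>. u x = - k" by auto
    then show False using nc unfolding constant_on_def by blast
  qed
qed

end
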